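(* Let $\mathfrak{L}$ be a symmetric Leibniz algebra over a field $\mathbb{F}$. Then the following statements are equivalent: (i) $\mathfrak{L}$ is nilpotent. (ii) $\mathfrak{L}_{\mathrm{Lie}}$ is nilpotent. (iii) $\mathfrak{L}/C(\mathfrak{L})$ is nilpotent. (iv) $\mathrm{Lie}(\mathfrak{L})$ is nilpotent.
   Context: An algebra over a field $\mathbb{F}$ is an $\mathbb{F}$-vector space (of arbitrary dimension) with a bilinear multiplication $(x,y)\mapsto xy$, not assumed associative. An ideal is a two-sided ideal. A symmetric Leibniz algebra is an algebra $\mathfrak{L}$ satisfying both the left Leibniz identity $x(yz)=(xy)z+y(xz)$ and the right Leibniz identity $(xy)z=(xz)y+x(yz)$ for all $x,y,z\in\mathfrak{L}$. An algebra is nilpotent if there is a positive integer $n$ such that any product of $n$ elements, no matter how associated, is zero (Lie algebras are regarded as algebras via their bracket). The Leibniz kernel is $\mathrm{Leib}(\mathfrak{L})$, the $\mathbb{F}$-span of $\{x^2=xx\mid x\in\mathfrak{L}\}$; it is an ideal of $\mathfrak{L}$, and $\mathfrak{L}_{\mathrm{Lie}}:=\mathfrak{L}/\mathrm{Leib}(\mathfrak{L})$ is the canonical Lie algebra associated to $\mathfrak{L}$. The center is $C(\mathfrak{L}):=\{c\in\mathfrak{L}\mid cx=0=xc \text{ for all } x\in\mathfrak{L}\}$, which is an ideal. For $a\in\mathfrak{L}$ let $L_a(x):=ax$ and $R_a(x):=xa$ be the left and right multiplication operators. The Lie multiplication algebra $\mathrm{Lie}(\mathfrak{L})$ is the Lie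 subalgebra of $\mathfrak{gl}(\mathfrak{L})$ (all linear operators on $\mathfrak{L}$ with the commutator bracket) generated by $\{L_a\mid a\in\mathfrak{L}\}\cup\{R_a\mid a\in\mathfrak{L}\}$. *)

theory Defs
  imports "HOL-Algebra.Module" "HOL-Algebra.QuotRing"
begin

text \<open>
  A non-associative algebra over a field is represented by a record of type
  \<^typ>\<open>('f, 'a) module\<close>, whose field \<^const>\<open>mult\<close> is the product of the algebra.
  The locale \<^locale>\<open>module\<close> puts no condition on \<^const>\<open>mult\<close> and \<^const>\<open>one\<close>; the
  latter has no meaning here.
\<close>

locale nonassoc_algebra = F?: field F + L?: module F L
  for F (structure) and L (structure) +
  assumes mult_closed:
      "\<lbrakk>x \<in> carrier L; y \<in> carrier L\<rbrakk> \<Longrightarrow> x \<otimes>\<^bsub>L\<^esub> y \<in> carrier L"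
    and mult_add_left:
      "\<lbrakk>x \<in> carrier L; y \<in> carrier L; z \<in> carrier L\<rbrakk> \<Longrightarrow>
        (x \<oplus>\<^bsub>L\<^esub> y) \<otimes>\<^bsub>L\<^esub> z = x \<otimes>\<^bsub>L\<^esub> z \<oplus>\<^bsub>L\<^esub> y \<otimes>\<^bsub>L\<^esub> z"
    and mult_add_right:
      "\<lbrakk>x \<in> carrier L; y \<in> carrier L; z \<in> carrier L\<rbrakk> \<Longrightarrow>
        x \<otimes>\<^bsub>L\<^esub> (y \<oplus>\<^bsub>L\<^esub> z) = x \<otimes>\<^bsub>L\<^esub> y \<oplus>\<^bsub>L\<^esub> x \<otimes>\<^bsub>L\<^esub> z"
    and mult_smult_left:
      "\<lbrakk>c \<in> carrier F; x \<in> carrier L; y \<in> carrier L\<rbrakk> \<Longrightarrow>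
        (c \<odot>\<^bsub>L\<^esub> x) \<otimes>\<^bsub>L\<^esub> y = c \<odot>\<^bsub>L\<^esub> (x \<otimes>\<^bsub>L\<^esub> y)"
    and mult_smult_right:
      "\<lbrakk>c \<in> carrier F; x \<in> carrier L; y \<in> carrier L\<rbrakk> \<Longrightarrow>
        x \<otimes>\<^bsub>L\<^esub> (c \<odot>\<^bsub>L\<^esub> y) = c \<odot>\<^bsub>L\<^esub> (x \<otimes>\<^bsub>L\<^esub> y)"

locale symmetric_leibniz_algebra = nonassoc_algebra +
  assumes left_leibniz:
      "\<lbrakk>x \<in> carrier L; y \<in> carrier L; z \<in> carrier L\<rbrakk> \<Longrightarrow>
        x \<otimes>\<^bsub>L\<^esub> (y \<otimes>\<^bsub>L\<^esub> z) = (x \<otimes>\<^bsub>L\<^esub> y) \<otimes>\<^bsub>L\<^esub> z \<oplus>\<^bsub>L\<^esub> y \<otimes>\<^bsub>L\<^esub> (x \<otimes>\<^bsub>L\<^esub> z)"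
    and right_leibniz:
      "\<lbrakk>x \<in> carrier L; y \<in> carrier L; z \<in> carrier L\<rbrakk> \<Longrightarrow>
        (x \<otimes>\<^bsub>L\<^esub> y) \<otimes>\<^bsub>L\<^esub> z = (x \<otimes>\<^bsub>L\<^esub> z) \<otimes>\<^bsub>L\<^esub> y \<oplus>\<^bsub>L\<^esub> x \<otimes>\<^bsub>L\<^esub> (y \<otimes>\<^bsub>L\<^esub> z)"

text \<open>\<open>nfold_product A n x\<close>: \<open>x\<close> is a product of \<open>n\<close> elements of \<open>A\<close>, bracketed in some way.\<close>

inductive nfold_product :: "('f, 'a, 'm) module_scheme \<Rightarrow> nat \<Rightarrow> 'a \<Rightarrow> bool"
  for A (structure) where
    single: "x \<in> carrier A \<Longrightarrow> nfold_product A 1 x"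
  | product: "\<lbrakk>nfold_product A m x; nfold_product A n y\<rbrakk> \<Longrightarrow> nfold_product A (m + n) (x \<otimes> y)"

definition nilpotent_algebra :: "('f, 'a, 'm) module_scheme \<Rightarrow> bool" where
  "nilpotent_algebra A \<longleftrightarrow> (\<exists>n>0. \<forall>x. nfold_product A n x \<longrightarrow> x = \<zero>\<^bsub>A\<^esub>)"

definition linear_span ::
    "('f, 'k) ring_scheme \<Rightarrow> ('f, 'a, 'm) module_scheme \<Rightarrow> 'a set \<Rightarrow> 'a set" where
  "linear_span F A S = \<Inter>{H. submodule H F A \<and> S \<subseteq> H}"

definition leibniz_kernel ::
    "('f, 'k) ring_scheme \<Rightarrow> ('f, 'a, 'm) module_scheme \<Rightarrow> 'a set" where
  "leibniz_kernel F L = linear_span F L {x \<otimes>\<^bsub>L\<^esub> x | x. x \<in> carrier L}"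

definition algebra_center :: "('f, 'a, 'm) module_scheme \<Rightarrow> 'a set" where
  "algebra_center L =
     {c \<in> carrier L. \<forall>x \<in> carrier L. c \<otimes>\<^bsub>L\<^esub> x = \<zero>\<^bsub>L\<^esub> \<and> x \<otimes>\<^bsub>L\<^esub> c = \<zero>\<^bsub>L\<^esub>}"

text \<open>
  The definition of \<^const>\<open>FactRing\<close> does not use associativity of the product. It is extended
  by the scalar multiplication of cosets, in the style of \<^const>\<open>rcoset_mult\<close>.
\<close>

definition quotient_algebra ::
    "('f, 'a, 'm) module_scheme \<Rightarrow> 'a set \<Rightarrow> ('f, 'a set) module" where
  "quotient_algebra L I =
     ring.extend (L Quot I) (module.fields (\<lambda>c X. \<Union>x\<in>X. I +>\<^bsub>L\<^esub> (c \<odot>\<^bsub>L\<^esub> x)))"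

definition canonical_lie_algebra ::
    "('f, 'k) ring_scheme \<Rightarrow> ('f, 'a, 'm) module_scheme \<Rightarrow> ('f, 'a set) module" where
  "canonical_lie_algebra F L = quotient_algebra L (leibniz_kernel F L)"

text \<open>
  Linear operators are represented extensionally (undefined outside the carrier), so that equality
  of operators is equality of functions.
\<close>

definition linear_operators ::
    "('f, 'k) ring_scheme \<Rightarrow> ('f, 'a, 'm) module_scheme \<Rightarrow> ('a \<Rightarrow> 'a) set" where
  "linear_operators F L =
     {f \<in> carrier L \<rightarrow>\<^sub>E carrier L.
        (\<forall>x \<in> carrier L. \<forall>y \<in> carrier L. f (x \<oplus>\<^bsub>L\<^esub> y) = f x \<oplus>\<^bsub>L\<^esub> f y) \<and>
        (\<forall>c \<in> carrier F. \<forall>x \<in> carrier L. f (c \<odot>\<^bsub>L\<^esub> x) = c \<odot>\<^bsub>L\<^esub> f x)}"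

definition general_linear_lie_algebra ::
    "('f, 'k) ring_scheme \<Rightarrow> ('f, 'a, 'm) module_scheme \<Rightarrow> ('f, 'a \<Rightarrow> 'a) module" where
  "general_linear_lie_algebra F L =
     \<lparr>carrier = linear_operators F L,
      mult = (\<lambda>f g. \<lambda>x \<in> carrier L. f (g x) \<ominus>\<^bsub>L\<^esub> g (f x)),
      one = undefined,
      zero = (\<lambda>x \<in> carrier L. \<zero>\<^bsub>L\<^esub>),
      add = (\<lambda>f g. \<lambda>x \<in> carrier L. f x \<oplus>\<^bsub>L\<^esub> g x),
      smult = (\<lambda>c f. \<lambda>x \<in> carrier L. c \<odot>\<^bsub>L\<^esub> f x)\<rparr>"

definition is_subalgebra ::
    "'a set \<Rightarrow> ('f, 'k) ring_scheme \<Rightarrow> ('f, 'a, 'm) module_scheme \<Rightarrow> bool" where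
  "is_subalgebra H F A \<longleftrightarrow> submodule H F A \<and> (\<forall>x \<in> H. \<forall>y \<in> H. x \<otimes>\<^bsub>A\<^esub> y \<in> H)"

definition generated_subalgebra ::
    "('f, 'k) ring_scheme \<Rightarrow> ('f, 'a, 'm) module_scheme \<Rightarrow> 'a set \<Rightarrow> ('f, 'a, 'm) module_scheme" where
  "generated_subalgebra F A S = A\<lparr>carrier := \<Inter>{H. is_subalgebra H F A \<and> S \<subseteq> H}\<rparr>"

definition left_mult :: "('f, 'a, 'm) module_scheme \<Rightarrow> 'a \<Rightarrow> 'a \<Rightarrow> 'a" where
  "left_mult L a = (\<lambda>x \<in> carrier L. a \<otimes>\<^bsub>L\<^esub> x)"

definition right_mult :: "('f, 'a, 'm) module_scheme \<Rightarrow> 'a \<Rightarrow> 'a \<Rightarrow> 'a" where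
  "right_mult L a = (\<lambda>x \<in> carrier L. x \<otimes>\<^bsub>L\<^esub> a)"

definition lie_multiplication_algebra ::
    "('f, 'k) ring_scheme \<Rightarrow> ('f, 'a, 'm) module_scheme \<Rightarrow> ('f, 'a \<Rightarrow> 'a) module" where
  "lie_multiplication_algebra F L =
     generated_subalgebra F (general_linear_lie_algebra F L)
       (left_mult L ` carrier L \<union> right_mult L ` carrier L)"

end

theory Submission
  imports Defs
begin

text \<open>
  Squares are central in a symmetric Leibniz algebra, so both \<open>Leib(L)\<close> and \<open>C(L)\<close> are central ideals,
  and factoring out a central ideal does not affect nilpotency: if all \<open>n\<close>-fold products are
  central, then all \<open>2n\<close>-fold products vanish.

  If \<open>L\<close> is nilpotent, the spans \<open>L\<^sup>k\<close> of the \<open>k\<close>-fold products form a finite filtration, and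
  an \<open>n\<close>-fold product in \<open>Lie(L)\<close> maps \<open>L\<^sup>k\<close> into \<open>L\<^sup>k\<^sup>+\<^sup>n\<close>. Conversely, \<open>L\<^sub>x\<^sub>y = [L\<^sub>x, L\<^sub>y]\<close> and
  \<open>R\<^sub>x\<^sub>y = [R\<^sub>y, R\<^sub>x]\<close>, so that the operators \<open>L\<^sub>x\<close> and \<open>R\<^sub>x\<close> of an \<open>n\<close>-fold product \<open>x\<close> are \<open>n\<close>-fold
  products in \<open>Lie(L)\<close>; if those vanish, \<open>x\<close> is central.
\<close>

section \<open>Products, linear spans and generated subalgebras\<close>

lemma nfold_product_pos: "nfold_product A n x \<Longrightarrow> 0 < n"
  by (induction rule: nfold_product.induct) auto

text \<open>The assumption puts the carrier itself into the family being intersected; without any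
  such submodule the intersection would be \<open>UNIV\<close>.\<close>

lemma (in module) submodule_linear_span:
  assumes "S \<subseteq> carrier M"
  shows "submodule (linear_span R M S) R M"
proof (rule submoduleI)
  show "linear_span R M S \<subseteq> carrier M"
    using assms carrier_is_submodule by (auto simp: linear_span_def)
  show "\<zero>\<^bsub>M\<^esub> \<in> linear_span R M S"
    by (auto simp: linear_span_def intro: subgroup.one_closed[OF submodule.axioms(1), simplified])
qed (auto simp: linear_span_def dest: submoduleE)

lemma linear_span_superset: "S \<subseteq> linear_span F L S"
  by (auto simp: linear_span_def)

lemma linear_span_minimal: "\<lbrakk>S \<subseteq> H; submodule H F L\<rbrakk> \<Longrightarrow> linear_span F L S \<subseteq> H"
  by (auto simp: linear_span_def)

lemma generated_subalgebra_simps [simp]: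
  "mult (generated_subalgebra F A S) = mult A"
  "zero (generated_subalgebra F A S) = zero A"
  by (simp_all add: generated_subalgebra_def)

lemma generated_subalgebra_superset: "S \<subseteq> carrier (generated_subalgebra F A S)"
  by (auto simp: generated_subalgebra_def)

lemma generated_subalgebra_minimal:
  "\<lbrakk>is_subalgebra H F A; S \<subseteq> H\<rbrakk> \<Longrightarrow> carrier (generated_subalgebra F A S) \<subseteq> H"
  by (auto simp: generated_subalgebra_def)

section \<open>The Lie algebra of all linear operators\<close>

lemma general_linear_simps [simp]:
  "carrier (general_linear_lie_algebra F L) = linear_operators F L"
  "mult (general_linear_lie_algebra F L) = (\<lambda>f g. \<lambda>x \<in> carrier L. f (g x) \<ominus>\<^bsub>L\<^esub> g (f x))"
  "zero (general_linear_lie_algebra F L) = (\<lambda>x \<in> carrier L. \<zero>\<^bsub>L\<^esub>)"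
  "add (general_linear_lie_algebra F L) = (\<lambda>f g. \<lambda>x \<in> carrier L. f x \<oplus>\<^bsub>L\<^esub> g x)"
  "smult (general_linear_lie_algebra F L) = (\<lambda>c f. \<lambda>x \<in> carrier L. c \<odot>\<^bsub>L\<^esub> f x)"
  by (simp_all add: general_linear_lie_algebra_def)

lemma linear_operatorsI:
  assumes "\<And>x. x \<in> carrier L \<Longrightarrow> f x \<in> carrier L"
    and "\<And>x y. \<lbrakk>x \<in> carrier L; y \<in> carrier L\<rbrakk> \<Longrightarrow> f (x \<oplus>\<^bsub>L\<^esub> y) = f x \<oplus>\<^bsub>L\<^esub> f y"
    and "\<And>c x. \<lbrakk>c \<in> carrier F; x \<in> carrier L\<rbrakk> \<Longrightarrow> f (c \<odot>\<^bsub>L\<^esub> x) = c \<odot>\<^bsub>L\<^esub> f x"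
    and "f \<in> extensional (carrier L)"
  shows "f \<in> linear_operators F L"
  using assms by (auto simp: linear_operators_def PiE_def)

lemma linear_operatorsD:
  assumes "f \<in> linear_operators F L"
  shows "x \<in> carrier L \<Longrightarrow> f x \<in> carrier L"
    and "\<lbrakk>x \<in> carrier L; y \<in> carrier L\<rbrakk> \<Longrightarrow> f (x \<oplus>\<^bsub>L\<^esub> y) = f x \<oplus>\<^bsub>L\<^esub> f y"
    and "\<lbrakk>c \<in> carrier F; x \<in> carrier L\<rbrakk> \<Longrightarrow> f (c \<odot>\<^bsub>L\<^esub> x) = c \<odot>\<^bsub>L\<^esub> f x"
    and "f \<in> extensional (carrier L)"
  using assms by (auto simp: linear_operators_def PiE_def)

context module
begin

text \<open>Commutativity of the scalars makes scalar multiples of linear operators linear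
  again.\<close>

lemma smult_m_comm:
  "\<lbrakk>a \<in> carrier R; b \<in> carrier R; x \<in> carrier M\<rbrakk> \<Longrightarrow> a \<odot>\<^bsub>M\<^esub> (b \<odot>\<^bsub>M\<^esub> x) = b \<odot>\<^bsub>M\<^esub> (a \<odot>\<^bsub>M\<^esub> x)"
  by (metis R.m_comm smult_assoc1)

lemma zero_linear_operator: "(\<lambda>x \<in> carrier M. \<zero>\<^bsub>M\<^esub>) \<in> linear_operators R M"
  by (rule linear_operatorsI) auto

lemma add_linear_operator:
  assumes "f \<in> linear_operators R M" "g \<in> linear_operators R M"
  shows "(\<lambda>x \<in> carrier M. f x \<oplus>\<^bsub>M\<^esub> g x) \<in> linear_operators R M"
  using linear_operatorsD[OF assms(1)] linear_operatorsD[OF assms(2)]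
  by (intro linear_operatorsI) (auto simp: smult_r_distr M.a_ac)

lemma smult_linear_operator:
  assumes "f \<in> linear_operators R M" "c \<in> carrier R"
  shows "(\<lambda>x \<in> carrier M. c \<odot>\<^bsub>M\<^esub> f x) \<in> linear_operators R M"
  using linear_operatorsD[OF assms(1)] assms(2)
  by (intro linear_operatorsI) (auto simp: smult_r_distr smult_m_comm)

lemma uminus_linear_operator:
  assumes "f \<in> linear_operators R M"
  shows "(\<lambda>x \<in> carrier M. \<ominus>\<^bsub>M\<^esub> f x) \<in> linear_operators R M"
  using linear_operatorsD[OF assms]
  by (intro linear_operatorsI) (auto simp: M.minus_add smult_r_minus)

lemma commutator_linear_operator:
  assumes "f \<in> linear_operators R M" "g \<in> linear_operators R M"
  shows "(\<lambda>x \<in> carrier M. f (g x) \<ominus>\<^bsub>M\<^esub> g (f x)) \<in> linear_operators R M"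
  using linear_operatorsD[OF assms(1)] linear_operatorsD[OF assms(2)]
  by (intro linear_operatorsI)
    (auto simp: smult_r_distr M.minus_eq M.minus_add smult_r_minus M.a_ac)

lemma abelian_group_general_linear: "abelian_group (general_linear_lie_algebra R M)"
proof (rule abelian_groupI, unfold general_linear_simps)
  fix f assume f: "f \<in> linear_operators R M"
  note fD = linear_operatorsD[OF f]
  \<comment> \<open>Off the carrier the left side is \<open>undefined\<close>; it equals f there
    because f is extensional.\<close>
  show "(\<lambda>x \<in> carrier M. (\<lambda>x \<in> carrier M. \<zero>\<^bsub>M\<^esub>) x \<oplus>\<^bsub>M\<^esub> f x) = f"
    by (rule extensionalityI[OF _ fD(4)]) (simp_all add: fD(1))
  show "\<exists>g \<in> linear_operators R M. (\<lambda>x \<in> carrier M. g x \<oplus>\<^bsub>M\<^esub> f x) = (\<lambda>x \<in> carrier M. \<zero>\<^bsub>M\<^esub>)"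
    by (rule bexI[OF _ uminus_linear_operator[OF f]]) (auto simp: fD(1) M.l_neg)
  fix g assume g: "g \<in> linear_operators R M"
  note gD = linear_operatorsD[OF g]
  show "(\<lambda>x \<in> carrier M. f x \<oplus>\<^bsub>M\<^esub> g x) = (\<lambda>x \<in> carrier M. g x \<oplus>\<^bsub>M\<^esub> f x)"
    by (rule restrict_ext) (simp add: fD(1) gD(1) M.a_comm)
  fix h assume h: "h \<in> linear_operators R M"
  show "(\<lambda>x \<in> carrier M. (\<lambda>x \<in> carrier M. f x \<oplus>\<^bsub>M\<^esub> g x) x \<oplus>\<^bsub>M\<^esub> h x) =
      (\<lambda>x \<in> carrier M. f x \<oplus>\<^bsub>M\<^esub> (\<lambda>x \<in> carrier M. g x \<oplus>\<^bsub>M\<^esub> h x) x)"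
    by (rule restrict_ext) (simp add: fD(1) gD(1) linear_operatorsD(1)[OF h] M.a_assoc)
qed (rule add_linear_operator zero_linear_operator; assumption?)+

text \<open>Closure under \<open>a_inv\<close> is part of \<open>submodule\<close>. The pointwise
  form comes from uniqueness of inverses in the additive group.\<close>

lemma general_linear_a_inv:
  assumes "f \<in> linear_operators R M"
  shows "\<ominus>\<^bsub>general_linear_lie_algebra R M\<^esub> f = (\<lambda>x \<in> carrier M. \<ominus>\<^bsub>M\<^esub> f x)"
  by (rule abelian_group.minus_equality[OF abelian_group_general_linear])
    (use assms in \<open>auto simp: uminus_linear_operator M.l_neg linear_operatorsD\<close>)

end

text \<open>The power \<open>L^k\<close>. A span is taken because sums of k-fold products need not
  be k-fold products. There are no 0-fold products, so in an algebra the span for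
  \<open>k = 0\<close> is trivial and the powers descend only from \<open>k = 1\<close> on.\<close>

definition power_span ::
    "('f, 'k) ring_scheme \<Rightarrow> ('f, 'a, 'm) module_scheme \<Rightarrow> nat \<Rightarrow> 'a set" where
  "power_span F A k = linear_span F A {x. nfold_product A k x}"

text \<open>The operators of degree at least j for the filtration by powers.\<close>

definition shifting_operators ::
    "('f, 'k) ring_scheme \<Rightarrow> ('f, 'a, 'm) module_scheme \<Rightarrow> nat \<Rightarrow> ('a \<Rightarrow> 'a) set" where
  "shifting_operators F A j =
     {f \<in> linear_operators F A. \<forall>k>0. f ` power_span F A k \<subseteq> power_span F A (k + j)}"

section \<open>Bilinearity and the number of factors of a product\<close>

context nonassoc_algebra
begin

lemma mult_zero_left [simp]: "x \<in> carrier L \<Longrightarrow> \<zero>\<^bsub>L\<^esub> \<otimes>\<^bsub>L\<^esub> x = \<zero>\<^bsub>L\<^esub>"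
  using mult_smult_left[of "\<zero>\<^bsub>F\<^esub>" x x] mult_smult_left[of "\<zero>\<^bsub>F\<^esub>" "\<zero>\<^bsub>L\<^esub>" x]
  by (simp add: mult_closed)

lemma mult_zero_right [simp]: "x \<in> carrier L \<Longrightarrow> x \<otimes>\<^bsub>L\<^esub> \<zero>\<^bsub>L\<^esub> = \<zero>\<^bsub>L\<^esub>"
  using mult_smult_right[of "\<zero>\<^bsub>F\<^esub>" x "\<zero>\<^bsub>L\<^esub>"] by (simp add: mult_closed)

lemma mult_minus_left:
  assumes "x \<in> carrier L" "y \<in> carrier L"
  shows "(\<ominus>\<^bsub>L\<^esub> x) \<otimes>\<^bsub>L\<^esub> y = \<ominus>\<^bsub>L\<^esub> (x \<otimes>\<^bsub>L\<^esub> y)"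
  using mult_add_left[of "\<ominus>\<^bsub>L\<^esub> x" x y] assms
  by (metis L.M.a_inv_closed L.M.minus_equality L.M.l_neg mult_closed mult_zero_left)

lemma mult_minus_right:
  assumes "x \<in> carrier L" "y \<in> carrier L"
  shows "y \<otimes>\<^bsub>L\<^esub> (\<ominus>\<^bsub>L\<^esub> x) = \<ominus>\<^bsub>L\<^esub> (y \<otimes>\<^bsub>L\<^esub> x)"
  using mult_add_right[of y "\<ominus>\<^bsub>L\<^esub> x" x] assms
  by (metis L.M.a_inv_closed L.M.minus_equality L.M.l_neg mult_closed mult_zero_right)

lemma nfold_product_closed: "nfold_product L n x \<Longrightarrow> x \<in> carrier L"
  by (induction rule: nfold_product.induct) (auto intro: mult_closed)

text \<open>Somewhere in the bracketing two single elements are multiplied, and their product can be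
  counted as one element. The induction descends into a side with more than one factor until both
  sides are single.\<close>

lemma nfold_product_pred:
  assumes "nfold_product L (Suc n) x" "0 < n"
  shows "nfold_product L n x"
proof -
  \<comment> \<open>The number of factors becomes a variable for the induction; \<open>1 < m\<close>
    keeps the truncated subtraction exact.\<close>
  have "nfold_product L m x \<Longrightarrow> 1 < m \<Longrightarrow> nfold_product L (m - 1) x" for m
  proof (induction rule: nfold_product.induct)
    case (product m x n y)
    show ?case
    proof (cases "1 < m")
      case True
      then have "nfold_product L ((m - 1) + n) (x \<otimes>\<^bsub>L\<^esub> y)"
        using product by (intro nfold_product.product) auto
      with True show ?thesis by simp
    next
      case False
      then have m: "m = 1"
        using product.hyps(1) nfold_product_pos by fastforce
      show ?thesis
      proof (cases "1 < n")
        case True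
        then have "nfold_product L (m + (n - 1)) (x \<otimes>\<^bsub>L\<^esub> y)"
          using product by (intro nfold_product.product) auto
        with True show ?thesis by simp
      next
        case False
        then have "n = 1"
          using product.hyps(2) nfold_product_pos by fastforce
        with m product show ?thesis
          using nfold_product.single[of "x \<otimes>\<^bsub>L\<^esub> y" L]
          by (simp add: nfold_product_closed mult_closed)
      qed
    qed
  qed simp
  from this[OF assms(1)] assms(2) show ?thesis by simp
qed

lemma nfold_product_antimono:
  assumes "n \<le> m" "nfold_product L m x" "0 < n"
  shows "nfold_product L n x"
  using assms
proof (induction rule: dec_induct)
  case (step m)
  then have "0 < m" by linarith
  with step show ?case by (blast intro: nfold_product_pred)
qed simp

section \<open>The center and quotients by central ideals\<close>

lemma submodule_algebra_center: "submodule (algebra_center L) F L"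
  by (rule L.submoduleI)
    (auto simp: algebra_center_def mult_add_left mult_add_right mult_smult_left mult_smult_right
      mult_minus_left mult_minus_right)

text \<open>One of the two outermost factors of a 2n-fold product has at least n factors itself. It
  is then also an n-fold product, hence central, and annihilates the other one.\<close>

lemma nilpotent_if_central:
  assumes "0 < n" and central: "\<And>x. nfold_product L n x \<Longrightarrow> x \<in> algebra_center L"
  shows "nilpotent_algebra L"
proof -
  have "x = \<zero>\<^bsub>L\<^esub>" if "nfold_product L (2 * n) x" for x
    using that
  proof cases
    \<comment> \<open>This would force \<open>2 * n = 1\<close>.\<close>
    case single
    then show ?thesis using \<open>0 < n\<close> by simp
  next
    case (product k a l b)
    then have "n \<le> k \<or> n \<le> l" by linarith
    then have "a \<in> algebra_center L \<or> b \<in> algebra_center L"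
      using product central nfold_product_antimono \<open>0 < n\<close> by blast
    with product show ?thesis
      by (auto simp: algebra_center_def nfold_product_closed)
  qed
  then show ?thesis
    using \<open>0 < n\<close> unfolding nilpotent_algebra_def by (intro exI[of _ "2 * n"]) auto
qed

text \<open>A submodule of the center is a two-sided ideal, since all products with its elements
  vanish. Products in the quotient are exactly the cosets of products in L; if the n-fold ones
  vanish in the quotient, those in L lie in I and are central.\<close>

lemma nilpotent_quotient_central_iff:
  assumes sub: "submodule I F L" and central: "I \<subseteq> algebra_center L"
  shows "nilpotent_algebra (quotient_algebra L I) \<longleftrightarrow> nilpotent_algebra L"
proof -
  let ?Q = "quotient_algebra L I"
  have sg: "subgroup I (add_monoid L)" using sub by (rule submodule.axioms)
  have subset: "I \<subseteq> carrier L" using L.submoduleE(1)[OF sub] .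
  have carrier_Q: "carrier ?Q = (\<lambda>x. I +>\<^bsub>L\<^esub> x) ` carrier L"
    by (auto simp: quotient_algebra_def ring.defs module.defs FactRing_def A_RCOSETS_def')
  have mult_Q: "(I +>\<^bsub>L\<^esub> x) \<otimes>\<^bsub>?Q\<^esub> (I +>\<^bsub>L\<^esub> y) = I +>\<^bsub>L\<^esub> (x \<otimes>\<^bsub>L\<^esub> y)"
    if "x \<in> carrier L" "y \<in> carrier L" for x y
  proof -
    \<comment> \<open>All terms with a factor from I vanish, so the product does not depend on the
      representatives.\<close>
    have "(h \<oplus>\<^bsub>L\<^esub> x) \<otimes>\<^bsub>L\<^esub> (h' \<oplus>\<^bsub>L\<^esub> y) = x \<otimes>\<^bsub>L\<^esub> y" if "h \<in> I" "h' \<in> I" for h h'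
      using that \<open>x \<in> carrier L\<close> \<open>y \<in> carrier L\<close> subsetD[OF central] subsetD[OF subset]
      by (simp add: algebra_center_def mult_add_left mult_add_right mult_closed)
    \<comment> \<open>This makes the cosets nonempty, so the union in \<open>rcoset_mult\<close> is
      the one common coset and not empty.\<close>
    moreover have "\<zero>\<^bsub>L\<^esub> \<in> I" using subgroup.one_closed[OF sg] by simp
    ultimately show ?thesis
      by (auto simp: quotient_algebra_def ring.defs module.defs FactRing_def rcoset_mult_def
          a_r_coset_def')
  qed
  have to_Q: "nfold_product L n x \<Longrightarrow> nfold_product ?Q n (I +>\<^bsub>L\<^esub> x)" for n x
  proof (induction rule: nfold_product.induct)
    case (single x)
    then show ?case by (intro nfold_product.single) (simp add: carrier_Q)
  next
    case (product m x n y)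
    then show ?case
      using nfold_product.product[of ?Q m _ n] mult_Q nfold_product_closed by metis
  qed
  \<comment> \<open>Representatives are chosen for the single factors and multiplied in L with the
    same bracketing.\<close>
  have from_Q: "nfold_product ?Q n X \<Longrightarrow> \<exists>x. nfold_product L n x \<and> X = I +>\<^bsub>L\<^esub> x" for n X
  proof (induction rule: nfold_product.induct)
    case (single X)
    then obtain x where "x \<in> carrier L" "X = I +>\<^bsub>L\<^esub> x" by (auto simp: carrier_Q)
    then show ?case using nfold_product.single[of x L] by (intro exI[of _ x]) simp
  next
    case (product m X n Y)
    then obtain x y where "nfold_product L m x" "X = I +>\<^bsub>L\<^esub> x" "nfold_product L n y" "Y = I +>\<^bsub>L\<^esub> y"
      by blast
    then show ?case
      using nfold_product.product[of L m x n y] mult_Q nfold_product_closed by blast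
  qed
  have zero_Q: "\<zero>\<^bsub>?Q\<^esub> = I"
    by (simp add: quotient_algebra_def ring.defs module.defs FactRing_def)
  show ?thesis
  proof
    assume "nilpotent_algebra ?Q"
    then obtain n where "0 < n" and n: "\<And>X. nfold_product ?Q n X \<Longrightarrow> X = I"
      unfolding nilpotent_algebra_def zero_Q by blast
    show "nilpotent_algebra L"
    proof (rule nilpotent_if_central[OF \<open>0 < n\<close>])
      fix x assume x: "nfold_product L n x"
      show "x \<in> algebra_center L"
        using L.M.a_coset_join1[OF n[OF to_Q[OF x]] nfold_product_closed[OF x] sg] central by blast
    qed
  next
    assume "nilpotent_algebra L"
    then obtain n where "0 < n" and n: "\<And>x. nfold_product L n x \<Longrightarrow> x = \<zero>\<^bsub>L\<^esub>"
      unfolding nilpotent_algebra_def by blast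
    have "X = I" if "nfold_product ?Q n X" for X
      using from_Q[OF that] n L.M.a_coset_add_zero[OF subset] by blast
    with \<open>0 < n\<close> show "nilpotent_algebra ?Q"
      unfolding nilpotent_algebra_def zero_Q by blast
  qed
qed

section \<open>Multiplication operators and the filtration by powers\<close>

lemma left_mult_linear: "a \<in> carrier L \<Longrightarrow> left_mult L a \<in> linear_operators F L"
  by (rule linear_operatorsI)
    (simp_all add: left_mult_def mult_closed mult_add_right mult_smult_right)

lemma right_mult_linear: "a \<in> carrier L \<Longrightarrow> right_mult L a \<in> linear_operators F L"
  by (rule linear_operatorsI)
    (simp_all add: right_mult_def mult_closed mult_add_left mult_smult_left)

lemma power_span_submodule: "submodule (power_span F L k) F L"
  unfolding power_span_def by (rule L.submodule_linear_span) (auto intro: nfold_product_closed)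

lemmas power_spanE = L.submoduleE[OF power_span_submodule]

lemma power_span_superset: "nfold_product L k x \<Longrightarrow> x \<in> power_span F L k"
  unfolding power_span_def by (rule subsetD[OF linear_span_superset]) simp

lemma power_span_antimono: "\<lbrakk>0 < k; k \<le> l\<rbrakk> \<Longrightarrow> power_span F L l \<subseteq> power_span F L k"
  unfolding power_span_def[of F L l]
  by (rule linear_span_minimal[OF _ power_span_submodule])
    (auto intro: power_span_superset nfold_product_antimono)

lemma linear_operator_zero: "f \<in> linear_operators F L \<Longrightarrow> f \<zero>\<^bsub>L\<^esub> = \<zero>\<^bsub>L\<^esub>"
  using linear_operatorsD(3)[of f F L "\<zero>\<^bsub>F\<^esub>" "\<zero>\<^bsub>L\<^esub>"] linear_operatorsD(1)[of f F L "\<zero>\<^bsub>L\<^esub>"] by simp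

text \<open>By minimality of spans, this reduces the claim that f maps a span into a submodule to a
  check on generators.\<close>

lemma submodule_preimage:
  assumes f: "f \<in> linear_operators F L" and H: "submodule H F L"
  shows "submodule {x \<in> carrier L. f x \<in> H} F L"
proof (rule L.submoduleI)
  show "\<ominus>\<^bsub>L\<^esub> x \<in> {x \<in> carrier L. f x \<in> H}" if "x \<in> {x \<in> carrier L. f x \<in> H}" for x
  proof -
    have "f (\<ominus>\<^bsub>L\<^esub> x) = \<ominus>\<^bsub>L\<^esub> f x"
      using that linear_operatorsD(2)[OF f, of "\<ominus>\<^bsub>L\<^esub> x" x] linear_operator_zero[OF f]
      by (intro L.M.minus_equality[symmetric]) (simp_all add: L.M.l_neg linear_operatorsD(1)[OF f])
    with that show ?thesis using L.submoduleE(3)[OF H] by auto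
  qed
  show "\<zero>\<^bsub>L\<^esub> \<in> {x \<in> carrier L. f x \<in> H}"
    using linear_operator_zero[OF f] subgroup.one_closed[OF submodule.axioms(1)[OF H]] by simp
qed (use linear_operatorsD[OF f] L.submoduleE[OF H] in auto)

lemma shifting_operatorsI:
  assumes f: "f \<in> linear_operators F L"
    and "\<And>k x. nfold_product L k x \<Longrightarrow> nfold_product L (k + j) (f x)"
  shows "f \<in> shifting_operators F L j"
proof -
  have "f x \<in> power_span F L (k + j)" if "x \<in> power_span F L k" for k x
  proof -
    have "power_span F L k \<subseteq> {x \<in> carrier L. f x \<in> power_span F L (k + j)}"
      unfolding power_span_def[of F L k]
      by (rule linear_span_minimal[OF _ submodule_preimage[OF f power_span_submodule]])
        (simp add: assms(2) power_span_superset nfold_product_closed subset_iff)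
    with that show ?thesis by blast
  qed
  with f show ?thesis by (simp add: shifting_operators_def image_subset_iff)
qed

lemma left_mult_shifting:
  assumes "a \<in> carrier L"
  shows "left_mult L a \<in> shifting_operators F L 1"
proof (rule shifting_operatorsI[OF left_mult_linear[OF assms]])
  fix k x assume "nfold_product L k x"
  then show "nfold_product L (k + 1) (left_mult L a x)"
    using nfold_product.product[OF nfold_product.single[OF assms], of k x]
    by (simp add: left_mult_def nfold_product_closed)
qed

lemma right_mult_shifting:
  assumes "a \<in> carrier L"
  shows "right_mult L a \<in> shifting_operators F L 1"
proof (rule shifting_operatorsI[OF right_mult_linear[OF assms]])
  fix k x assume "nfold_product L k x"
  then show "nfold_product L (k + 1) (right_mult L a x)"
    using nfold_product.product[OF _ nfold_product.single[OF assms], of k x]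
    by (simp add: right_mult_def nfold_product_closed)
qed

lemma shifting_operatorsD:
  assumes "f \<in> shifting_operators F L j" "0 < k" "x \<in> power_span F L k"
  shows "f x \<in> power_span F L (k + j)"
  using assms by (auto simp: shifting_operators_def)

text \<open>Degrees add under composition in either order, and each power is closed under
  differences.\<close>

lemma commutator_shifting:
  assumes f: "f \<in> shifting_operators F L i" and g: "g \<in> shifting_operators F L j"
  shows "(\<lambda>x \<in> carrier L. f (g x) \<ominus>\<^bsub>L\<^esub> g (f x)) \<in> shifting_operators F L (i + j)"
proof -
  have lin: "f \<in> linear_operators F L" "g \<in> linear_operators F L"
    using f g by (auto simp: shifting_operators_def)
  have "f (g x) \<ominus>\<^bsub>L\<^esub> g (f x) \<in> power_span F L (k + (i + j))"
    if "0 < k" "x \<in> power_span F L k" for k x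
  proof -
    have "f (g x) \<in> power_span F L (k + (i + j))"
      using shifting_operatorsD[OF f _ shifting_operatorsD[OF g that]] that(1)
      by (simp add: ac_simps)
    moreover have "g (f x) \<in> power_span F L (k + (i + j))"
      using shifting_operatorsD[OF g _ shifting_operatorsD[OF f that]] that(1)
      by (simp add: ac_simps)
    ultimately show ?thesis
      by (simp add: L.M.minus_eq power_spanE)
  qed
  \<comment> \<open>The commutator is restricted to the carrier, which contains every power, so its
    values there are the expected ones.\<close>
  moreover have "x \<in> carrier L" if "x \<in> power_span F L k" for x k
    using that power_spanE(1) by blast
  ultimately show ?thesis
    using L.commutator_linear_operator[OF lin]
    by (simp add: shifting_operators_def image_subset_iff)
qed

text \<open>The bracket of two operators of degree 1 has degree 2, hence also degree at least 1,
  because the powers descend. This confines all of \<open>Lie(L)\<close> to degree at least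
  1.\<close>

lemma is_subalgebra_shifting_operators:
  "is_subalgebra (shifting_operators F L 1) F (general_linear_lie_algebra F L)"
proof -
  let ?G = "general_linear_lie_algebra F L"
  have carrier: "x \<in> carrier L" if "x \<in> power_span F L k" for x k
    using that power_spanE(1) by blast
  have zero: "\<zero>\<^bsub>L\<^esub> \<in> power_span F L k" for k
    using subgroup.one_closed[OF submodule.axioms(1)[OF power_span_submodule]] by simp
  have "subgroup (shifting_operators F L 1) (add_monoid ?G)"
  proof (rule subgroup.intro)
    fix f assume "f \<in> shifting_operators F L 1"
    then show "inv\<^bsub>add_monoid ?G\<^esub> f \<in> shifting_operators F L 1"
      \<comment> \<open>Folding to \<open>a_inv\<close> makes the pointwise formula for the inverse
        applicable.\<close>
      unfolding a_inv_def[symmetric]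
      by (auto simp: shifting_operators_def L.general_linear_a_inv L.uminus_linear_operator
          carrier power_spanE image_subset_iff)
  qed (auto simp: shifting_operators_def L.zero_linear_operator L.add_linear_operator
      carrier zero power_spanE image_subset_iff)
  moreover have "c \<odot>\<^bsub>?G\<^esub> f \<in> shifting_operators F L 1"
    if "c \<in> carrier F" "f \<in> shifting_operators F L 1" for c f
    using that by (auto simp: shifting_operators_def L.smult_linear_operator
        carrier power_spanE image_subset_iff)
  moreover have "f \<otimes>\<^bsub>?G\<^esub> g \<in> shifting_operators F L 1"
    if "f \<in> shifting_operators F L 1" "g \<in> shifting_operators F L 1" for f g
  proof -
    have "shifting_operators F L (1 + 1) \<subseteq> shifting_operators F L 1"
    proof
      fix h assume h: "h \<in> shifting_operators F L (1 + 1)"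
      have "h ` power_span F L k \<subseteq> power_span F L (k + 1)" if "0 < k" for k
        using h that power_span_antimono[of "k + 1" "k + (1 + 1)"]
        by (fastforce dest: shifting_operatorsD)
      with h show "h \<in> shifting_operators F L 1" by (simp add: shifting_operators_def)
    qed
    with commutator_shifting[OF that] show ?thesis by auto
  qed
  ultimately show ?thesis
    by (simp add: is_subalgebra_def submodule_def submodule_axioms_def)
qed

text \<open>The generators have degree 1, so by minimality every element of \<open>Lie(L)\<close>
  does; each bracket then adds degrees.\<close>

lemma nfold_product_lie_multiplication_shifting:
  "nfold_product (lie_multiplication_algebra F L) n f \<Longrightarrow> f \<in> shifting_operators F L n"
proof (induction rule: nfold_product.induct)
  case (single f)
  have "left_mult L ` carrier L \<union> right_mult L ` carrier L \<subseteq> shifting_operators F L 1"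
    using left_mult_shifting right_mult_shifting by blast
  then show ?case
    using single generated_subalgebra_minimal[OF is_subalgebra_shifting_operators]
    unfolding lie_multiplication_algebra_def by blast
next
  case (product m f n g)
  then show ?case
    unfolding lie_multiplication_algebra_def generated_subalgebra_simps general_linear_simps
    by (intro commutator_shifting)
qed

lemma nilpotent_lie_multiplication_algebra:
  assumes "nilpotent_algebra L"
  shows "nilpotent_algebra (lie_multiplication_algebra F L)"
proof -
  obtain n where "0 < n" and n: "\<And>x. nfold_product L n x \<Longrightarrow> x = \<zero>\<^bsub>L\<^esub>"
    using assms unfolding nilpotent_algebra_def by blast
  have zero_sub: "submodule {\<zero>\<^bsub>L\<^esub>} F L"
    by (rule L.submoduleI) auto
  have "power_span F L n \<subseteq> {\<zero>\<^bsub>L\<^esub>}"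
    unfolding power_span_def using n by (intro linear_span_minimal zero_sub) auto
  \<comment> \<open>The carrier is the first power, so an operator of degree n maps it into power
    \<open>1 + n\<close>, one below the power known to vanish.\<close>
  then have bot: "power_span F L (1 + n) \<subseteq> {\<zero>\<^bsub>L\<^esub>}"
    using power_span_antimono[of n "1 + n"] \<open>0 < n\<close> by auto
  have "f = (\<lambda>x \<in> carrier L. \<zero>\<^bsub>L\<^esub>)" if "nfold_product (lie_multiplication_algebra F L) n f" for f
  proof -
    have f: "f \<in> shifting_operators F L n"
      using that by (rule nfold_product_lie_multiplication_shifting)
    have "f x = \<zero>\<^bsub>L\<^esub>" if "x \<in> carrier L" for x
      using shifting_operatorsD[OF f zero_less_one
          power_span_superset[OF nfold_product.single[OF that]]] bot
      by auto
    \<comment> \<open>Extensionality turns vanishing on the carrier into equality with the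
      restricted zero operator.\<close>
    moreover have "f \<in> extensional (carrier L)"
      using f linear_operatorsD(4) by (auto simp: shifting_operators_def)
    ultimately show ?thesis by (auto intro: extensionalityI)
  qed
  with \<open>0 < n\<close> show ?thesis
    by (auto simp: nilpotent_algebra_def lie_multiplication_algebra_def)
qed

end

section \<open>Consequences of the two Leibniz identities\<close>

context symmetric_leibniz_algebra
begin

text \<open>The left identity for x, x, y reads \<open>x(xy) = (xx)y + x(xy)\<close>, and the right
  one for y, x, x reads \<open>(yx)x = (yx)x + y(xx)\<close>; cancel.\<close>

lemma square_central:
  assumes "x \<in> carrier L"
  shows "x \<otimes>\<^bsub>L\<^esub> x \<in> algebra_center L"
proof -
  have "(x \<otimes>\<^bsub>L\<^esub> x) \<otimes>\<^bsub>L\<^esub> y = \<zero>\<^bsub>L\<^esub>" "y \<otimes>\<^bsub>L\<^esub> (x \<otimes>\<^bsub>L\<^esub> x) = \<zero>\<^bsub>L\<^esub>" if "y \<in> carrier L" for y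
    using left_leibniz[of x x y] right_leibniz[of y x x] assms that
    by (metis L.M.add.l_cancel_one' L.M.add.r_cancel_one' mult_closed)+
  with assms show ?thesis by (simp add: algebra_center_def mult_closed)
qed

lemma submodule_leibniz_kernel: "submodule (leibniz_kernel F L) F L"
  unfolding leibniz_kernel_def by (rule L.submodule_linear_span) (auto intro: mult_closed)

lemma leibniz_kernel_central: "leibniz_kernel F L \<subseteq> algebra_center L"
  unfolding leibniz_kernel_def
  by (rule linear_span_minimal[OF _ submodule_algebra_center]) (auto intro: square_central)

text \<open>This is the left Leibniz identity solved for \<open>(xy)z\<close>.\<close>

lemma left_mult_mult:
  assumes "x \<in> carrier L" "y \<in> carrier L"
  shows "left_mult L (x \<otimes>\<^bsub>L\<^esub> y) = left_mult L x \<otimes>\<^bsub>lie_multiplication_algebra F L\<^esub> left_mult L y"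
proof -
  have "(x \<otimes>\<^bsub>L\<^esub> y) \<otimes>\<^bsub>L\<^esub> z = x \<otimes>\<^bsub>L\<^esub> (y \<otimes>\<^bsub>L\<^esub> z) \<ominus>\<^bsub>L\<^esub> y \<otimes>\<^bsub>L\<^esub> (x \<otimes>\<^bsub>L\<^esub> z)" if "z \<in> carrier L" for z
    using assms that by (simp add: left_leibniz[of x y z] L.M.minus_eq L.M.a_assoc L.M.r_neg mult_closed)
  with assms show ?thesis
    by (auto simp: left_mult_def lie_multiplication_algebra_def mult_closed fun_eq_iff restrict_def)
qed

text \<open>The right Leibniz identity gives \<open>z(xy) = (zx)y - (zy)x\<close>. As operators act
  from the left, the first term applies \<open>right_mult L x\<close> first, which reverses the
  order.\<close>

lemma right_mult_mult:
  assumes "x \<in> carrier L" "y \<in> carrier L"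
  shows "right_mult L (x \<otimes>\<^bsub>L\<^esub> y) = right_mult L y \<otimes>\<^bsub>lie_multiplication_algebra F L\<^esub> right_mult L x"
proof -
  have "z \<otimes>\<^bsub>L\<^esub> (x \<otimes>\<^bsub>L\<^esub> y) = (z \<otimes>\<^bsub>L\<^esub> x) \<otimes>\<^bsub>L\<^esub> y \<ominus>\<^bsub>L\<^esub> (z \<otimes>\<^bsub>L\<^esub> y) \<otimes>\<^bsub>L\<^esub> x" if "z \<in> carrier L" for z
    using assms that
    by (simp add: right_leibniz[of z x y] L.M.minus_eq L.M.a_ac L.M.r_neg1 L.M.r_neg mult_closed)
  with assms show ?thesis
    by (auto simp: right_mult_def lie_multiplication_algebra_def mult_closed fun_eq_iff restrict_def)
qed

lemma nfold_product_left_mult: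
  "nfold_product L n x \<Longrightarrow> nfold_product (lie_multiplication_algebra F L) n (left_mult L x)"
proof (induction rule: nfold_product.induct)
  case (single x)
  then show ?case
    using generated_subalgebra_superset
    by (intro nfold_product.single) (fastforce simp: lie_multiplication_algebra_def)
next
  case (product m x n y)
  then show ?case
    by (simp add: left_mult_mult nfold_product_closed nfold_product.product)
qed

lemma nfold_product_right_mult:
  "nfold_product L n x \<Longrightarrow> nfold_product (lie_multiplication_algebra F L) n (right_mult L x)"
proof (induction rule: nfold_product.induct)
  case (single x)
  then show ?case
    using generated_subalgebra_superset
    by (intro nfold_product.single) (fastforce simp: lie_multiplication_algebra_def)
next
  case (product m x n y)
  then show ?case
    \<comment> \<open>The reversal yields \<open>n + m\<close> factors instead of
      \<open>m + n\<close>.\<close>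
    by (simp add: right_mult_mult nfold_product_closed nfold_product.product add.commute[of m])
qed

text \<open>Both operators of an n-fold product x are n-fold products in \<open>Lie(L)\<close>,
  hence zero, which says precisely that x is central.\<close>

lemma nilpotent_if_nilpotent_lie_multiplication_algebra:
  assumes "nilpotent_algebra (lie_multiplication_algebra F L)"
  shows "nilpotent_algebra L"
proof -
  obtain n where "0 < n" and n: "\<And>f. nfold_product (lie_multiplication_algebra F L) n f \<Longrightarrow>
      f = (\<lambda>x \<in> carrier L. \<zero>\<^bsub>L\<^esub>)"
    using assms unfolding nilpotent_algebra_def lie_multiplication_algebra_def by auto
  show ?thesis
  proof (rule nilpotent_if_central[OF \<open>0 < n\<close>])
    fix x assume x: "nfold_product L n x"
    have "left_mult L x y = \<zero>\<^bsub>L\<^esub>" "right_mult L x y = \<zero>\<^bsub>L\<^esub>" if "y \<in> carrier L" for y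
      using n[OF nfold_product_left_mult[OF x]] n[OF nfold_product_right_mult[OF x]] that
      by simp_all
    with x show "x \<in> algebra_center L"
      by (simp add: algebra_center_def left_mult_def right_mult_def nfold_product_closed)
  qed
qed

end

theorem theorem5p12:
  fixes F :: "('f, 'k) ring_scheme" and L :: "('f, 'a, 'm) module_scheme"
  assumes "symmetric_leibniz_algebra F L"
  shows "(nilpotent_algebra L \<longleftrightarrow> nilpotent_algebra (canonical_lie_algebra F L)) \<and>
         (nilpotent_algebra L \<longleftrightarrow> nilpotent_algebra (quotient_algebra L (algebra_center L))) \<and>
         (nilpotent_algebra L \<longleftrightarrow> nilpotent_algebra (lie_multiplication_algebra F L))"
proof -
  interpret symmetric_leibniz_algebra F L by (rule assms)
  show ?thesis
    \<comment> \<open>The two quotients are instances of one lemma, for the Leibniz kernel and for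
      the whole center.\<close>
    using nilpotent_quotient_central_iff[OF submodule_leibniz_kernel leibniz_kernel_central]
      nilpotent_quotient_central_iff[OF submodule_algebra_center order_refl]
      nilpotent_lie_multiplication_algebra nilpotent_if_nilpotent_lie_multiplication_algebra
    by (auto simp: canonical_lie_algebra_def)
qed

end
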